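(* Let $\delta\in\mathbb C^\times$ and let $(\mathcal A,\circ)$ be a $\delta$-mock-Novikov algebra over $\mathbb C$. Define $\{x,y\}=x\circ y+y\circ x$ for $x,y\in\mathcal A$. Then $(\mathcal A,\circ,\{-,-\})$ is a $\delta$-mock-Gelfand-Dorfman algebra.
   Context: The ground field is $\mathbb C$; an algebra is a vector space with a bilinear product, not necessarily associative. A $\delta$-mock-Novikov algebra is an algebra $(\mathcal A,\circ)$ such that for all $a,b,c\in\mathcal A$ $$\delta(a\circ b)\circ c+\delta(b\circ a)\circ c+a\circ(b\circ c)+b\circ(a\circ c)=0,\qquad (a\circ b)\circ c+(a\circ c)\circ b=0.$$ A mock-Lie algebra is a vector space with a symmetric bilinear product $\{-,-\}$ satisfying $\{\{x,y\},z\}+\{\{y,z\},x\}+\{\{z,x\},y\}=0$. A $\delta$-mock-Gelfand-Dorfman algebra is a triple $(\mathcal A,\circ,\{-,-\})$ where $(\mathcal A,\circ)$ is a $\delta$-mock-Novikov algebra, $(\mathcal A,\{-,-\})$ is a mock-Lie algebra, and for all $x,y,z\in\mathcal A$ $$\{x,y\circ z\}+\{z,y\circ x\}+\delta\{y,x\}\circ z+\delta\{y,z\}\circ x+y\circ\{x,z\}=0.$$ *)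

theory Defs
  imports Complex_Main
begin

locale complex_algebra = vector_space scale
  for scale :: "complex \<Rightarrow> 'a::ab_group_add \<Rightarrow> 'a" (infixr \<open>*\<^sub>C\<close> 75) +
  fixes prod :: "'a \<Rightarrow> 'a \<Rightarrow> 'a"
  assumes linear_left: "Vector_Spaces.linear (*\<^sub>C) (*\<^sub>C) (\<lambda>a. prod a b)"
    and linear_right: "Vector_Spaces.linear (*\<^sub>C) (*\<^sub>C) (\<lambda>b. prod a b)"

locale mock_Novikov_algebra = complex_algebra scale prod
  for \<delta> :: complex
    and scale :: "complex \<Rightarrow> 'a::ab_group_add \<Rightarrow> 'a" (infixr \<open>*\<^sub>C\<close> 75)
    and prod :: "'a \<Rightarrow> 'a \<Rightarrow> 'a" (infixl \<open>\<odot>\<close> 80) +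
  assumes left_identity:
      "\<delta> *\<^sub>C ((a \<odot> b) \<odot> c) + \<delta> *\<^sub>C ((b \<odot> a) \<odot> c) + a \<odot> (b \<odot> c) + b \<odot> (a \<odot> c) = 0"
    and right_identity: "(a \<odot> b) \<odot> c + (a \<odot> c) \<odot> b = 0"

locale mock_Lie_algebra = complex_algebra scale bracket
  for scale :: "complex \<Rightarrow> 'a::ab_group_add \<Rightarrow> 'a" (infixr \<open>*\<^sub>C\<close> 75)
    and bracket :: "'a \<Rightarrow> 'a \<Rightarrow> 'a" +
  assumes symmetric: "bracket x y = bracket y x"
    and Jacobi: "bracket (bracket x y) z + bracket (bracket y z) x + bracket (bracket z x) y = 0"

locale mock_Gelfand_Dorfman_algebra =
  mock_Novikov_algebra \<delta> scale prod + mock_Lie_algebra scale bracket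
  for \<delta> :: complex
    and scale :: "complex \<Rightarrow> 'a::ab_group_add \<Rightarrow> 'a" (infixr \<open>*\<^sub>C\<close> 75)
    and prod :: "'a \<Rightarrow> 'a \<Rightarrow> 'a" (infixl \<open>\<odot>\<close> 80)
    and bracket :: "'a \<Rightarrow> 'a \<Rightarrow> 'a" +
  assumes compatibility:
    "bracket x (y \<odot> z) + bracket z (y \<odot> x) + \<delta> *\<^sub>C (bracket y x \<odot> z)
      + \<delta> *\<^sub>C (bracket y z \<odot> x) + y \<odot> bracket x z = 0"

end

theory Submission
  imports Defs
begin

text \<open>Both nontrivial axioms are sums of instances of the two mock-Novikov identities.
  Expanding the cyclic sum of the bracket gives all six products
  \<open>(a \<odot> b) \<odot> c\<close> and all six \<open>a \<odot> (b \<odot> c)\<close> over the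
  permutations of x, y, z; each family vanishes separately (\<open>anticommutator_Jacobi\<close>).
  The compatibility condition splits into one instance of \<open>right_identity\<close> and two of
  \<open>left_identity\<close> (\<open>anticommutator_compatibility\<close>). Bilinearity and
  symmetry of the bracket are immediate.\<close>

context complex_algebra
begin

lemma prod_add_left: "prod (a + b) c = prod a c + prod b c"
  using linear_left[of c] by (simp add: Vector_Spaces.linear_iff)

lemma prod_add_right: "prod a (b + c) = prod a b + prod a c"
  using linear_right[of a] by (simp add: Vector_Spaces.linear_iff)

lemma complex_algebra_anticommutator:
  "complex_algebra scale (\<lambda>x y. prod x y + prod y x)"
proof (intro complex_algebra.intro complex_algebra_axioms.intro vector_space_axioms)
  fix b
  interpret vector_space_pair scale scale ..
  show "Vector_Spaces.linear scale scale (\<lambda>a. prod a b + prod b a)"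
    by (intro linear_compose_add linear_left linear_right)
  show "Vector_Spaces.linear scale scale (\<lambda>a. prod b a + prod a b)"
    by (intro linear_compose_add linear_left linear_right)
qed

end

context mock_Novikov_algebra
begin

lemma anticommutator_Jacobi:
  defines "br \<equiv> \<lambda>x y. x \<odot> y + y \<odot> x"
  shows "br (br x y) z + br (br y z) x + br (br z x) y = 0"
proof -
  define l where "l a b c = (a \<odot> b) \<odot> c" for a b c
  define r where "r a b c = a \<odot> (b \<odot> c)" for a b c
  \<comment> \<open>Each pair fixes the leftmost factor and swaps the other two, so it cancels by
    \<open>right_identity\<close>.\<close>
  have L: "(l x y z + l x z y) + (l y z x + l y x z) + (l z x y + l z y x) = 0"
    using right_identity by (simp add: l_def)
  \<comment> \<open>\<open>left_identity\<close> is symmetric in its first two arguments, so letting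
    each of x, y, z be the last one once collects every permutation: \<delta> times the sum in
    \<open>L\<close>, plus the sum of all right-nested products. As the former vanishes, so does the
    latter.\<close>
  have "\<delta> *\<^sub>C ((l x y z + l x z y) + (l y z x + l y x z) + (l z x y + l z y x))
      + ((r z x y + r x z y) + (r z y x + r y z x) + (r x y z + r y x z))
    = (\<delta> *\<^sub>C l z x y + \<delta> *\<^sub>C l x z y + r z x y + r x z y)
      + (\<delta> *\<^sub>C l z y x + \<delta> *\<^sub>C l y z x + r z y x + r y z x)
      + (\<delta> *\<^sub>C l x y z + \<delta> *\<^sub>C l y x z + r x y z + r y x z)"
    by (simp add: scale_right_distrib algebra_simps)
  also have "\<dots> = 0"
    using left_identity by (simp add: l_def r_def)
  finally have R: "(r z x y + r x z y) + (r z y x + r y z x) + (r x y z + r y x z) = 0"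
    by (simp add: L)
  have "br (br x y) z + br (br y z) x + br (br z x) y
    = ((l x y z + l x z y) + (l y z x + l y x z) + (l z x y + l z y x))
      + ((r z x y + r x z y) + (r z y x + r y z x) + (r x y z + r y x z))"
    by (simp add: br_def l_def r_def prod_add_left prod_add_right algebra_simps)
  then show ?thesis
    by (simp add: L R)
qed

lemma anticommutator_compatibility:
  defines "br \<equiv> \<lambda>x y. x \<odot> y + y \<odot> x"
  shows "br x (y \<odot> z) + br z (y \<odot> x) + \<delta> *\<^sub>C (br y x \<odot> z) + \<delta> *\<^sub>C (br y z \<odot> x) + y \<odot> br x z = 0"
    (is "?lhs = 0")
proof -
  \<comment> \<open>The terms without \<delta> whose outer product has x or z on the right form the
    \<open>right_identity\<close> instance; the others form \<open>left_identity\<close> at (x, y,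
    z) and at (z, y, x).\<close>
  have "?lhs = ((y \<odot> z) \<odot> x + (y \<odot> x) \<odot> z)
    + (\<delta> *\<^sub>C ((x \<odot> y) \<odot> z) + \<delta> *\<^sub>C ((y \<odot> x) \<odot> z) + x \<odot> (y \<odot> z) + y \<odot> (x \<odot> z))
    + (\<delta> *\<^sub>C ((z \<odot> y) \<odot> x) + \<delta> *\<^sub>C ((y \<odot> z) \<odot> x) + z \<odot> (y \<odot> x) + y \<odot> (z \<odot> x))"
    by (simp add: br_def prod_add_left prod_add_right scale_right_distrib algebra_simps)
  then show ?thesis
    by (simp only: left_identity right_identity add_0_left)
qed

end

theorem proposition6p11:
  fixes \<delta> :: complex
    and scale :: "complex \<Rightarrow> 'a::ab_group_add \<Rightarrow> 'a"
    and prod :: "'a \<Rightarrow> 'a \<Rightarrow> 'a"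
  assumes "\<delta> \<noteq> 0"
    and "mock_Novikov_algebra \<delta> scale prod"
  shows "mock_Gelfand_Dorfman_algebra \<delta> scale prod (\<lambda>x y. prod x y + prod y x)"
proof -
  interpret mock_Novikov_algebra \<delta> scale prod
    by fact
  interpret bracket: complex_algebra scale "\<lambda>x y. prod x y + prod y x"
    by (rule complex_algebra_anticommutator)
  show ?thesis
    by unfold_locales
      (rule add.commute anticommutator_Jacobi anticommutator_compatibility)+
qed

end
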